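(* Let $s\in\mathcal X$. Consider the problem $$(P)\qquad \inf_{\pi\in\Pi_{\rm MR}} w_0^\pi(s)\quad\text{subject to } w_i^\pi(s)\le b_i \ \text{ for all } 1\le i\le K,$$ and the problem $$(\bar P)\qquad \min_{\eta\in\bar\Pi} v^{\eta}_{T,0}(s,\mathbf 1)\quad\text{subject to } v^{\eta}_{T,i}(s,\mathbf 1)\le b_i \ \text{ for all } 1\le i\le K .$$ Then the optimal values of $(P)$ and $(\bar P)$ are equal. Furthermore, $\eta^*\in\bar\Pi$ is an optimizer of $(\bar P)$ if and only if $\Gamma(\eta^* )$ is an optimizer of $(P)$.
   Context: **Original model.** $\mathcal X$ (states) and $\mathcal A$ (actions) are finite nonempty sets, $T>0$ is an integer (terminal time), and $Q(x'\mid x,a)$ is a transition law: the probability of moving to state $x'$ when action $a$ is taken in state $x$. A Markovian randomized (MR) decision rule is a map $d:\mathcal X\to\mathcal P(\mathcal A)$, where $\mathcal P(\mathcal A)$ is the set of probability distributions on $\mathcal A$; $d(a\mid x)$ is the probability of choosing $a$ in state $x$. An MR policy is a sequence $\pi=\{d_t\}_{t=0}^{T-1}$ of MR decision rules; $\Pi_{\rm MR}$ is the set of MR policies. A policy $\pi$ and initial state $s$ induce the usual probability measure $P_s^\pi$ on trajectories $(X_0,A_0,\dots,X_{T-1},A_{T-1},X_T)$: $X_0=s$, $A_t$ is drawn from $d_t(\cdot\mid X_t)$, and $X_{t+1}$ is drawn from $Q(\cdot\mid X_t,A_t)$. Its expectation is $\mathbb E_s^\pi$. **Costs.** $K\ge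 0$ is an integer. For $0\le i\le K$ and $0\le t\le T-1$ there are functions $r_{t,i},f_{t,i}:\mathcal X\times\mathcal A\times\mathcal X\to\mathbb R$ with $0\le f_{t,i}\le 1$ (standing assumption), reals $\alpha_i\neq 0$ for $0\le i\le K$ (standing assumption in the construction), and reals $b_i$. Define $$w_i^\pi(s)=\mathbb E_s^\pi\Big[\sum_{t=0}^{T-1}r_{t,i}(X_t,A_t,X_{t+1})+\alpha_i\prod_{t=0}^{T-1}f_{t,i}(X_t,A_t,X_{t+1})\Big].$$ **Augmented model.** Let $\mathcal Z=\{0,1\}^{K+1}$ (coordinates indexed $0,\dots,K$), $\bar{\mathcal X}=\mathcal X\times\mathcal Z$, $\mathbf 1=(1,\dots,1)\in\mathcal Z$. For $t\in\{1,\dots,T\}$, the transition law from epoch $t-1$ to epoch $t$ is $$\bar Q_t\big((x',z')\mid(x,z),a\big)=\begin{cases}0,&\text{if } z_i=0 \text{ and } z_i'=1\text{ for at least one } i,\\ Q(x'\mid x,a)\prod_{i=0}^K (f_{t-1,i}(x,a,x'))^{z_iz_i'}(1-f_{t-1,i}(x,a,x'))^{z_i(1-z_i')},&\text{otherwise,}\end{cases}$$ with the convention $0^0=1$. MR policies $\eta=\{\bar d_t\}_{t=0}^{T-1}$ for the augmented model are defined as before with $\bar{\mathcal X}$ in place of $\mathcal X$; $P^\eta_{(x,z)}$, $\mathbb E^\eta_{(x,z)}$ denote the induced law and expectation for the process $(X_t,Z_t)_{t=0}^T$, $(A_t)_{t=0}^{T-1}$ started at $(X_0,Z_0)=(x,z)$,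 with $A_t\sim\bar d_t(\cdot\mid(X_t,Z_t))$ and $(X_{t+1},Z_{t+1})\sim\bar Q_{t+1}(\cdot\mid(X_t,Z_t),A_t)$. $\bar\Pi$ is the set of MR policies $\{\bar d_t\}$ of the augmented model that are indifferent to $z$: $\bar d_t(a\mid(x,z))=\bar d_t(a\mid(x,\mathbf 1))$ for all $t,x,z,a$. The map $\Gamma:\bar\Pi\to\Pi_{\rm MR}$ is $\Gamma(\{\bar d_t\})=\{d_t\}$ with $d_t(a\mid x)=\bar d_t(a\mid(x,\mathbf 1))$. Stage-wise costs: $\bar r_{t,i}((x,z),a)=\sum_{x'\in\mathcal X}r_{t,i}(x,a,x')Q(x'\mid x,a)$ for $t<T$, and $\bar r_{T,i}(x,z)=\alpha_iz_i$. Define $$v^\eta_{T,i}(x,z)=\mathbb E^\eta_{(x,z)}\Big[\sum_{t=0}^{T-1}\bar r_{t,i}((X_t,Z_t),A_t)+\bar r_{T,i}(X_T,Z_T)\Big].$$ The optimal value of a problem is the infimum of its objective over its feasible set ($+\infty$ if the feasible set is empty); an optimizer is a feasible policy attaining it. *)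

theory Defs
  imports "HOL-Probability.Probability"
begin

section \<open>Finite-horizon Markov decision processes\<close>

text \<open>
  A policy assigns to every decision epoch \<open>t < T\<close> a decision rule, that is, a map from the
  state set \<open>S\<close> to distributions on actions. Extensionality (the value \<open>undefined\<close> off the
  domain) makes two policies equal exactly if they agree on \<open>{..<T}\<close> and \<open>S\<close>.
\<close>

definition MR_policies :: "nat \<Rightarrow> 's set \<Rightarrow> (nat \<Rightarrow> 's \<Rightarrow> 'a pmf) set" where
  "MR_policies T S = ({..<T} \<rightarrow>\<^sub>E (S \<rightarrow>\<^sub>E UNIV))"

text \<open>
  \<open>trajectory P d s n\<close> is the law of \<open>(X\<^sub>0, A\<^sub>0, \<dots>, X\<^bsub>n-1\<^esub>, A\<^bsub>n-1\<^esub>, X\<^sub>n)\<close> started in \<open>s\<close>, as a pair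
  of sequences whose later entries are \<open>undefined\<close>. The kernel \<open>P t\<close> leads from epoch \<open>t - 1\<close>
  to epoch \<open>t\<close>.
\<close>

primrec trajectory ::
  "(nat \<Rightarrow> 's \<Rightarrow> 'a \<Rightarrow> 's pmf) \<Rightarrow> (nat \<Rightarrow> 's \<Rightarrow> 'a pmf) \<Rightarrow> 's \<Rightarrow> nat
    \<Rightarrow> ((nat \<Rightarrow> 's) \<times> (nat \<Rightarrow> 'a)) pmf" where
  "trajectory P d s 0 = return_pmf ((\<lambda>_. undefined)(0 := s), \<lambda>_. undefined)"
| "trajectory P d s (Suc n) =
    bind_pmf (trajectory P d s n) (\<lambda>(X, A).
    bind_pmf (d n (X n)) (\<lambda>a.
    bind_pmf (P (Suc n) (X n) a) (\<lambda>x'.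
    return_pmf (X(Suc n := x'), A(n := a)))))"

section \<open>Constrained problems\<close>

definition feasible_set :: "'p set \<Rightarrow> (nat \<Rightarrow> 'p \<Rightarrow> real) \<Rightarrow> nat \<Rightarrow> (nat \<Rightarrow> real) \<Rightarrow> 'p set" where
  "feasible_set Pol c K b = {p \<in> Pol. \<forall>i\<in>{1..K}. c i p \<le> b i}"

definition optimal_value :: "'p set \<Rightarrow> (nat \<Rightarrow> 'p \<Rightarrow> real) \<Rightarrow> nat \<Rightarrow> (nat \<Rightarrow> real) \<Rightarrow> ereal" where
  "optimal_value Pol c K b = (INF p\<in>feasible_set Pol c K b. ereal (c 0 p))"

definition is_optimizer ::
  "'p set \<Rightarrow> (nat \<Rightarrow> 'p \<Rightarrow> real) \<Rightarrow> nat \<Rightarrow> (nat \<Rightarrow> real) \<Rightarrow> 'p \<Rightarrow> bool" where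
  "is_optimizer Pol c K b p \<longleftrightarrow>
    p \<in> feasible_set Pol c K b \<and> ereal (c 0 p) = optimal_value Pol c K b"

section \<open>The original model\<close>

text \<open>In \<open>r\<close> and \<open>f\<close> the first argument is the epoch \<open>t\<close> and the second the cost index \<open>i\<close>.\<close>

definition w_cost ::
  "nat \<Rightarrow> ('x \<Rightarrow> 'a \<Rightarrow> 'x pmf) \<Rightarrow> (nat \<Rightarrow> nat \<Rightarrow> 'x \<Rightarrow> 'a \<Rightarrow> 'x \<Rightarrow> real)
    \<Rightarrow> (nat \<Rightarrow> nat \<Rightarrow> 'x \<Rightarrow> 'a \<Rightarrow> 'x \<Rightarrow> real) \<Rightarrow> (nat \<Rightarrow> real)
    \<Rightarrow> nat \<Rightarrow> (nat \<Rightarrow> 'x \<Rightarrow> 'a pmf) \<Rightarrow> 'x \<Rightarrow> real" where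
  "w_cost T Q r f \<alpha> i \<pi> s =
    measure_pmf.expectation (trajectory (\<lambda>_. Q) \<pi> s T)
      (\<lambda>(X, A). (\<Sum>t<T. r t i (X t) (A t) (X (Suc t)))
              + \<alpha> i * (\<Prod>t<T. f t i (X t) (A t) (X (Suc t))))"

section \<open>The augmented model\<close>

definition Zset :: "nat \<Rightarrow> (nat \<Rightarrow> nat) set" where
  "Zset K = ({0..K} \<rightarrow>\<^sub>E {0, 1})"

definition ones :: "nat \<Rightarrow> nat \<Rightarrow> nat" where
  "ones K = (\<lambda>i\<in>{0..K}. 1)"

definition aug_states :: "nat \<Rightarrow> ('x \<times> (nat \<Rightarrow> nat)) set" where
  "aug_states K = UNIV \<times> Zset K"

definition Qbar_mass ::
  "nat \<Rightarrow> ('x \<Rightarrow> 'a \<Rightarrow> 'x pmf) \<Rightarrow> (nat \<Rightarrow> nat \<Rightarrow> 'x \<Rightarrow> 'a \<Rightarrow> 'x \<Rightarrow> real)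
    \<Rightarrow> nat \<Rightarrow> 'x \<times> (nat \<Rightarrow> nat) \<Rightarrow> 'a \<Rightarrow> 'x \<times> (nat \<Rightarrow> nat) \<Rightarrow> real" where
  "Qbar_mass K Q f t = (\<lambda>(x, z) a (x', z').
    if \<exists>i\<in>{0..K}. z i = 0 \<and> z' i = 1 then 0
    else pmf (Q x a) x' *
      (\<Prod>i\<in>{0..K}. f (t - 1) i x a x' ^ (z i * z' i)
                  * (1 - f (t - 1) i x a x') ^ (z i * (1 - z' i))))"

definition Qbar ::
  "nat \<Rightarrow> ('x \<Rightarrow> 'a \<Rightarrow> 'x pmf) \<Rightarrow> (nat \<Rightarrow> nat \<Rightarrow> 'x \<Rightarrow> 'a \<Rightarrow> 'x \<Rightarrow> real)
    \<Rightarrow> nat \<Rightarrow> 'x \<times> (nat \<Rightarrow> nat) \<Rightarrow> 'a \<Rightarrow> ('x \<times> (nat \<Rightarrow> nat)) pmf" where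
  "Qbar K Q f t y a =
    embed_pmf (\<lambda>y'. if y' \<in> aug_states K then Qbar_mass K Q f t y a y' else 0)"

text \<open>
  \<^const>\<open>embed_pmf\<close> is only meaningful for functions that are nonnegative and sum to one;
  the following lemma shows that this holds here, so that the mass function of
  \<^const>\<open>Qbar\<close> is the intended one.
\<close>

lemma Zset_sum_one:
  assumes z: "z \<in> Zset K"
  shows "(\<Sum>z'\<in>Zset K. if \<exists>i\<in>{0..K}. z i = 0 \<and> z' i = 1 then 0
      else (\<Prod>i\<in>{0..K}. p i ^ (z i * z' i) * (1 - p i :: real) ^ (z i * (1 - z' i)))) = 1"
proof -
  define g where "g i j = (if z i = 0 \<and> j = 1 then 0
      else p i ^ (z i * j) * (1 - p i) ^ (z i * (1 - j)))" for i and j :: nat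
  have "(if \<exists>i\<in>{0..K}. z i = 0 \<and> z' i = 1 then 0
      else (\<Prod>i\<in>{0..K}. p i ^ (z i * z' i) * (1 - p i) ^ (z i * (1 - z' i))))
      = (\<Prod>i\<in>{0..K}. g i (z' i))" for z'
  proof (cases "\<exists>i\<in>{0..K}. z i = 0 \<and> z' i = 1")
    case True
    then obtain i where i: "i \<in> {0..K}" "z i = 0 \<and> z' i = 1"
      by blast
    then have "g i (z' i) = 0"
      by (simp add: g_def)
    with i(1) have "(\<Prod>i\<in>{0..K}. g i (z' i)) = 0"
      by (intro prod_zero) auto
    with True show ?thesis
      by (simp only: if_True)
  next
    case False
    then have "g i (z' i) = p i ^ (z i * z' i) * (1 - p i) ^ (z i * (1 - z' i))"
      if "i \<in> {0..K}" for i
      using that unfolding g_def by (metis (no_types))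
    with False show ?thesis
      by (simp only: if_False cong: prod.cong)
  qed
  then have "(\<Sum>z'\<in>Zset K. if \<exists>i\<in>{0..K}. z i = 0 \<and> z' i = 1 then 0
      else (\<Prod>i\<in>{0..K}. p i ^ (z i * z' i) * (1 - p i) ^ (z i * (1 - z' i))))
      = (\<Sum>z'\<in>Pi\<^sub>E {0..K} (\<lambda>_. {0, 1}). \<Prod>i\<in>{0..K}. g i (z' i))"
    by (simp add: Zset_def)
  also have "\<dots> = (\<Prod>i\<in>{0..K}. \<Sum>j\<in>{0, 1}. g i j)"
    by (rule prod_sum_PiE[symmetric]) auto
  also have "\<dots> = 1"
  proof (rule prod.neutral, intro ballI)
    fix i assume "i \<in> {0..K}"
    then have "z i = 0 \<or> z i = 1"
      using PiE_mem[OF z[unfolded Zset_def]] by blast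
    then show "(\<Sum>j\<in>{0, 1}. g i j) = 1"
      by (auto simp: g_def)
  qed
  finally show ?thesis .
qed

lemma pmf_Qbar:
  fixes Q :: "'x::finite \<Rightarrow> 'a \<Rightarrow> 'x pmf"
  assumes y: "y \<in> aug_states K"
    and f: "\<And>i x a x'. i \<le> K \<Longrightarrow> 0 \<le> f (t - 1) i x a x' \<and> f (t - 1) i x a x' \<le> 1"
  shows "pmf (Qbar K Q f t y a) y' = (if y' \<in> aug_states K then Qbar_mass K Q f t y a y' else 0)"
proof -
  obtain x z where y_eq: "y = (x, z)" and z: "z \<in> Zset K"
    using y by (auto simp: aug_states_def)
  let ?h = "\<lambda>y'. if y' \<in> aug_states K then Qbar_mass K Q f t y a y' else 0"
  have fin: "finite (Zset K)" "finite (aug_states K :: ('x \<times> (nat \<Rightarrow> nat)) set)"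
    by (auto simp: Zset_def aug_states_def intro!: finite_PiE)
  have nn: "0 \<le> ?h y'" for y'
  proof -
    obtain x' z' where y'_eq: "y' = (x', z')"
      by (cases y')
    have "0 \<le> (\<Prod>i\<in>{0..K}. f (t - 1) i x a x' ^ (z i * z' i)
                  * (1 - f (t - 1) i x a x') ^ (z i * (1 - z' i)))"
      using f by (intro prod_nonneg ballI mult_nonneg_nonneg zero_le_power) (auto simp: le_diff_eq)
    then have "0 \<le> Qbar_mass K Q f t y a y'"
      unfolding Qbar_mass_def y_eq y'_eq prod.case by (simp only: pmf_nonneg mult_nonneg_nonneg order_refl split: if_split) simp
    then show ?thesis
      by simp
  qed
  have pull: "(if c then 0 else p * q) = p * (if c then 0 else q)" for c and p q :: real
    by simp
  have "(\<Sum>y'\<in>aug_states K. ?h y')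
      = (\<Sum>x'\<in>UNIV. \<Sum>z'\<in>Zset K. Qbar_mass K Q f t y a (x', z'))"
    by (simp add: aug_states_def sum.cartesian_product)
  also have "\<dots> = (\<Sum>x'\<in>UNIV. pmf (Q x a) x' *
      (\<Sum>z'\<in>Zset K. if \<exists>i\<in>{0..K}. z i = 0 \<and> z' i = 1 then 0
        else (\<Prod>i\<in>{0..K}. f (t - 1) i x a x' ^ (z i * z' i)
                        * (1 - f (t - 1) i x a x') ^ (z i * (1 - z' i)))))"
    unfolding Qbar_mass_def y_eq prod.case sum_distrib_left
    by (intro sum.cong refl) (rule pull)
  also have "\<dots> = (\<Sum>x'\<in>UNIV. pmf (Q x a) x')"
    by (simp only: Zset_sum_one[OF z] mult_1_right)
  also have "\<dots> = 1"
    by (rule sum_pmf_eq_1) auto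
  finally have sum1: "(\<Sum>y'\<in>aug_states K. ?h y') = 1" .
  have "(\<integral>\<^sup>+ y'. ennreal (?h y') \<partial>count_space UNIV) = (\<Sum>y'\<in>aug_states K. ennreal (?h y'))"
    by (rule nn_integral_count_space'[OF fin(2)]) auto
  also have "\<dots> = ennreal (\<Sum>y'\<in>aug_states K. ?h y')"
    by (rule sum_ennreal) (rule nn)
  finally have "(\<integral>\<^sup>+ y'. ennreal (?h y') \<partial>count_space UNIV) = 1"
    by (simp only: sum1 ennreal_1)
  with nn show ?thesis
    unfolding Qbar_def by (rule pmf_embed_pmf)
qed

definition Pi_bar :: "nat \<Rightarrow> nat \<Rightarrow> (nat \<Rightarrow> 'x \<times> (nat \<Rightarrow> nat) \<Rightarrow> 'a pmf) set" where
  "Pi_bar T K = {\<eta> \<in> MR_policies T (aug_states K).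
    \<forall>t<T. \<forall>x. \<forall>z\<in>Zset K. \<forall>a. pmf (\<eta> t (x, z)) a = pmf (\<eta> t (x, ones K)) a}"

definition Gamma_map :: "nat \<Rightarrow> nat \<Rightarrow> (nat \<Rightarrow> 'x \<times> (nat \<Rightarrow> nat) \<Rightarrow> 'a pmf) \<Rightarrow> (nat \<Rightarrow> 'x \<Rightarrow> 'a pmf)" where
  "Gamma_map T K \<eta> = (\<lambda>t\<in>{..<T}. \<lambda>x. \<eta> t (x, ones K))"

definition rbar ::
  "('x::finite \<Rightarrow> 'a \<Rightarrow> 'x pmf) \<Rightarrow> (nat \<Rightarrow> nat \<Rightarrow> 'x \<Rightarrow> 'a \<Rightarrow> 'x \<Rightarrow> real)
    \<Rightarrow> nat \<Rightarrow> nat \<Rightarrow> 'x \<times> (nat \<Rightarrow> nat) \<Rightarrow> 'a \<Rightarrow> real" where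
  "rbar Q r t i = (\<lambda>(x, z) a. \<Sum>x'\<in>UNIV. r t i x a x' * pmf (Q x a) x')"

definition rbar_terminal :: "(nat \<Rightarrow> real) \<Rightarrow> nat \<Rightarrow> 'x \<times> (nat \<Rightarrow> nat) \<Rightarrow> real" where
  "rbar_terminal \<alpha> i = (\<lambda>(x, z). \<alpha> i * real (z i))"

definition v_cost ::
  "nat \<Rightarrow> nat \<Rightarrow> ('x::finite \<Rightarrow> 'a \<Rightarrow> 'x pmf) \<Rightarrow> (nat \<Rightarrow> nat \<Rightarrow> 'x \<Rightarrow> 'a \<Rightarrow> 'x \<Rightarrow> real)
    \<Rightarrow> (nat \<Rightarrow> nat \<Rightarrow> 'x \<Rightarrow> 'a \<Rightarrow> 'x \<Rightarrow> real) \<Rightarrow> (nat \<Rightarrow> real)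
    \<Rightarrow> nat \<Rightarrow> (nat \<Rightarrow> 'x \<times> (nat \<Rightarrow> nat) \<Rightarrow> 'a pmf) \<Rightarrow> 'x \<times> (nat \<Rightarrow> nat) \<Rightarrow> real" where
  "v_cost T K Q r f \<alpha> i \<eta> y =
    measure_pmf.expectation (trajectory (Qbar K Q f) \<eta> y T)
      (\<lambda>(Y, A). (\<Sum>t<T. rbar Q r t i (Y t) (A t)) + rbar_terminal \<alpha> i (Y T))"

end

theory Submission
  imports Defs
begin

text \<open>
  The flag \<open>z i\<close> survives the step from epoch \<open>t\<close> to epoch \<open>t + 1\<close> with conditional probability
  \<open>f t i (X t) (A t) (X (t + 1))\<close>. Under a policy that ignores the flags, conditioning on the last
  step shows by induction that weighting by the flag at epoch \<open>n\<close> has the same effect in mean as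
  weighting by the product of the first \<open>n\<close> factors in the original model, while the states
  have the same law. Hence \<open>\<eta>\<close> and its image under \<open>\<Gamma>\<close> have the same costs, and \<open>\<Gamma>\<close> maps onto all
  policies of the original model.
\<close>

section \<open>Means along trajectories of a chain on a finite state set\<close>

lemma expectation_bind_pmf_finite:
  fixes g :: "'b \<Rightarrow> real"
  assumes "finite (set_pmf p)" "\<And>x. x \<in> set_pmf p \<Longrightarrow> finite (set_pmf (q x))"
  shows "measure_pmf.expectation (bind_pmf p q) g
    = measure_pmf.expectation p (\<lambda>x. measure_pmf.expectation (q x) g)"
proof -
  have "measure_pmf.expectation (bind_pmf p q) g
      = (\<Sum>x\<in>set_pmf p. pmf p x *\<^sub>R measure_pmf.expectation (q x) g)"
    by (rule pmf_expectation_bind) (use assms in auto)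
  also have "\<dots> = measure_pmf.expectation p (\<lambda>x. measure_pmf.expectation (q x) g)"
    by (rule integral_measure_pmf[symmetric]) (use assms in auto)
  finally show ?thesis .
qed

lemma expectation_pmf_cong:
  assumes "\<And>x. x \<in> set_pmf p \<Longrightarrow> g x = h x"
  shows "measure_pmf.expectation p g = measure_pmf.expectation p h"
  by (rule integral_cong_AE) (use assms in \<open>auto simp: AE_measure_pmf_iff\<close>)

text \<open>Conditional mean of \<open>c (X n) (A n) (X (Suc n))\<close> given
  \<open>X n = x\<close>; since the rules are Markovian, this is a function of the current state
  alone.\<close>

definition step_mean ::
  "(nat \<Rightarrow> 's \<Rightarrow> 'a \<Rightarrow> 's pmf) \<Rightarrow> (nat \<Rightarrow> 's \<Rightarrow> 'a pmf)
    \<Rightarrow> nat \<Rightarrow> ('s \<Rightarrow> 'a \<Rightarrow> 's \<Rightarrow> real) \<Rightarrow> 's \<Rightarrow> real" where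
  "step_mean P d n c x = measure_pmf.expectation (d n x)
    (\<lambda>a. measure_pmf.expectation (P (Suc n) x a) (c x a))"

declare trajectory.simps(2) [simp del]

text \<open>Covers both models. Augmented states live in an infinite type, so finiteness comes from
  confinement to \<open>S\<close>. Confinement is required for the first \<open>N\<close> steps
  only, because the bounds on \<open>f\<close>, and with them the support of \<open>Qbar\<close>,
  are known only up to the horizon.\<close>

locale finite_chain =
  fixes P :: "nat \<Rightarrow> 's \<Rightarrow> 'a::finite \<Rightarrow> 's pmf" and d :: "nat \<Rightarrow> 's \<Rightarrow> 'a pmf"
    and s :: 's and S :: "'s set" and N :: nat
  assumes finite_S: "finite S"
    and s_in_S: "s \<in> S"
    and step_in_S: "\<And>n x a. n < N \<Longrightarrow> x \<in> S \<Longrightarrow> set_pmf (P (Suc n) x a) \<subseteq> S"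
begin

abbreviation mean :: "nat \<Rightarrow> ((nat \<Rightarrow> 's) \<times> (nat \<Rightarrow> 'a) \<Rightarrow> real) \<Rightarrow> real" where
  "mean n g \<equiv> measure_pmf.expectation (trajectory P d s n) g"

text \<open>Both claims share one induction: the next support is finite because the kernel, started
  from a state in \<open>S\<close>, charges only the finite set \<open>S\<close>.\<close>

lemma trajectory_finite_in_S:
  "n \<le> N \<Longrightarrow> finite (set_pmf (trajectory P d s n)) \<and> (\<forall>h\<in>set_pmf (trajectory P d s n). fst h n \<in> S)"
proof (induction n)
  case 0
  then show ?case by (simp add: s_in_S)
next
  case (Suc n)
  then have "finite (set_pmf (P (Suc n) (fst h n) a))" if "h \<in> set_pmf (trajectory P d s n)" for h a
    using that step_in_S[of n "fst h n" a] finite_subset[OF _ finite_S] by auto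
  then show ?case
    using Suc step_in_S[of n] by (fastforce simp: trajectory.simps(2) case_prod_unfold)
qed

lemma integrable_trajectory:
  fixes g :: "_ \<Rightarrow> real"
  shows "n \<le> N \<Longrightarrow> integrable (measure_pmf (trajectory P d s n)) g"
  using trajectory_finite_in_S by (intro integrable_measure_pmf_finite) auto

text \<open>Restricting to \<open>X n \<in> S\<close> matters because the one-step identities for
  \<open>Qbar\<close> hold only on \<open>aug_states K\<close>.\<close>

lemma mean_cong:
  assumes "n \<le> N" "\<And>X A. X n \<in> S \<Longrightarrow> g (X, A) = h (X, A)"
  shows "mean n g = mean n h"
  by (rule expectation_pmf_cong) (use assms trajectory_finite_in_S in force)

text \<open>Tower property: condition on the first \<open>n\<close> steps, then average over the
  action and the next state.\<close>

lemma mean_Suc: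
  assumes "n < N"
  shows "mean (Suc n) g = mean n (\<lambda>(X, A). measure_pmf.expectation (d n (X n))
    (\<lambda>a. measure_pmf.expectation (P (Suc n) (X n) a) (\<lambda>x'. g (X(Suc n := x'), A(n := a)))))"
proof -
  have fin: "finite (set_pmf (trajectory P d s n))"
    using assms trajectory_finite_in_S[of n] by simp
  have finP: "finite (set_pmf (P (Suc n) (fst h n) a))" if "h \<in> set_pmf (trajectory P d s n)" for h a
    using that assms trajectory_finite_in_S[of n] step_in_S[of n "fst h n" a]
      finite_subset[OF _ finite_S] by auto
  have "mean (Suc n) g = mean n (\<lambda>h. measure_pmf.expectation
      (bind_pmf (d n (fst h n)) (\<lambda>a. bind_pmf (P (Suc n) (fst h n) a)
        (\<lambda>x'. return_pmf ((fst h)(Suc n := x'), (snd h)(n := a))))) g)"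
    unfolding trajectory.simps case_prod_unfold
    by (rule expectation_bind_pmf_finite) (use fin finP in auto)
  also have "\<dots> = mean n (\<lambda>h. measure_pmf.expectation (d n (fst h n))
    (\<lambda>a. measure_pmf.expectation (P (Suc n) (fst h n) a)
      (\<lambda>x'. g ((fst h)(Suc n := x'), (snd h)(n := a)))))"
    using finP by (intro expectation_pmf_cong) (simp add: expectation_bind_pmf_finite)
  finally show ?thesis
    by (simp only: case_prod_unfold)
qed

text \<open>By linearity each stage cost may be replaced by its conditional mean given the state at
  that stage, so additive costs depend only on the laws of the single states.\<close>

lemma mean_additive:
  "n \<le> N \<Longrightarrow> mean n (\<lambda>(X, A). \<Sum>t<n. c t (X t) (A t) (X (Suc t)))
    = (\<Sum>t<n. mean t (\<lambda>(X, A). step_mean P d t (c t) (X t)))"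
proof (induction n)
  case 0
  then show ?case by simp
next
  case (Suc n)
  then have n: "n < N" by simp
  \<comment> \<open>For \<open>t < n\<close> the summand reads states up to index \<open>n\<close>
    and actions below \<open>n\<close>, so the updates at \<open>Suc n\<close> and \<open>n\<close>
    are invisible.\<close>
  have pres: "(\<Sum>t<n. c t ((X(Suc n := x')) t) ((A(n := a)) t) ((X(Suc n := x')) (Suc t)))
      = (\<Sum>t<n. c t (X t) (A t) (X (Suc t)))" for X A x' a
    by (intro sum.cong) auto
  have finP: "integrable (measure_pmf (P (Suc n) x a)) g" if "x \<in> S" for x a and g :: "'s \<Rightarrow> real"
    using that n step_in_S finite_S by (meson finite_subset integrable_measure_pmf_finite)
  have "mean (Suc n) (\<lambda>(X, A). \<Sum>t<Suc n. c t (X t) (A t) (X (Suc t)))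
    = mean n (\<lambda>(X, A). measure_pmf.expectation (d n (X n))
    (\<lambda>a. measure_pmf.expectation (P (Suc n) (X n) a)
      (\<lambda>x'. (\<Sum>t<n. c t (X t) (A t) (X (Suc t))) + c n (X n) a x')))"
    unfolding mean_Suc[OF n] prod.case sum.lessThan_Suc pres by simp
  also have "\<dots> = mean n (\<lambda>h. (case h of (X, A) \<Rightarrow> \<Sum>t<n. c t (X t) (A t) (X (Suc t)))
      + (case h of (X, A) \<Rightarrow> step_mean P d n (c n) (X n)))"
    using n finP by (intro mean_cong) (auto simp: step_mean_def integrable_measure_pmf_finite)
  also have "\<dots> = mean n (\<lambda>(X, A). \<Sum>t<n. c t (X t) (A t) (X (Suc t)))
      + mean n (\<lambda>(X, A). step_mean P d n (c n) (X n))"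
    using n by (intro Bochner_Integration.integral_add integrable_trajectory) auto
  finally show ?case
    using Suc by simp
qed

lemma mean_state_Suc:
  assumes "n < N"
  shows "mean (Suc n) (\<lambda>(X, A). h (X (Suc n)))
    = mean n (\<lambda>(X, A). step_mean P d n (\<lambda>_ _. h) (X n))"
  unfolding mean_Suc[OF assms] by (simp add: step_mean_def)

text \<open>The last factor is absorbed into the test function: its conditional mean against
  \<open>h\<close> is again a function of \<open>X n\<close>, which lets an induction continue with
  a new \<open>h\<close>.\<close>

lemma mean_multiplicative_Suc:
  assumes n: "n < N"
  shows "mean (Suc n) (\<lambda>(X, A). (\<Prod>t<Suc n. c t (X t) (A t) (X (Suc t))) * h (X (Suc n)))
    = mean n (\<lambda>(X, A). (\<Prod>t<n. c t (X t) (A t) (X (Suc t)))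
        * step_mean P d n (\<lambda>x a x'. c n x a x' * h x') (X n))"
proof -
  have pres: "(\<Prod>t<n. c t ((X(Suc n := x')) t) ((A(n := a)) t) ((X(Suc n := x')) (Suc t)))
      = (\<Prod>t<n. c t (X t) (A t) (X (Suc t)))" for X A x' a
    by (intro prod.cong) auto
  show ?thesis
    unfolding mean_Suc[OF n] prod.case prod.lessThan_Suc pres
    by (simp add: step_mean_def mult.assoc)
qed

end

section \<open>Means of states and flags under the augmented kernel\<close>

lemma finite_Zset: "finite (Zset K)"
  by (auto simp: Zset_def intro!: finite_PiE)

lemma ones_in_Zset: "ones K \<in> Zset K"
  by (auto simp: ones_def Zset_def)

text \<open>Given \<open>z\<close>, the new flags are independent. The weight \<open>z' i\<close>
  enters only the factor of coordinate \<open>i\<close>, so the sum over the product set splits into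
  one sum per coordinate: \<open>z i * p i\<close> at \<open>i\<close> and 1 elsewhere.\<close>

lemma Zset_sum_coord:
  assumes z: "z \<in> Zset K" and i: "i \<le> K"
  shows "(\<Sum>z'\<in>Zset K. real (z' i) * (if \<exists>j\<in>{0..K}. z j = 0 \<and> z' j = 1 then 0
      else (\<Prod>j\<in>{0..K}. p j ^ (z j * z' j) * (1 - p j :: real) ^ (z j * (1 - z' j)))))
    = real (z i) * p i"
proof -
  \<comment> \<open>The global ban on a flag rising from 0 to 1 is moved into the single factors,
    which makes the summand a product over coordinates.\<close>
  define g where "g j m = (if z j = 0 \<and> m = 1 then 0
      else p j ^ (z j * m) * (1 - p j) ^ (z j * (1 - m)))" for j and m :: nat
  define g' where "g' j m = (if j = i then real m else 1) * g j m" for j and m :: nat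
  have z01: "z j = 0 \<or> z j = 1" if "j \<le> K" for j
    using PiE_mem[OF z[unfolded Zset_def], of j] that by auto
  have "(if \<exists>j\<in>{0..K}. z j = 0 \<and> z' j = 1 then 0
      else (\<Prod>j\<in>{0..K}. p j ^ (z j * z' j) * (1 - p j) ^ (z j * (1 - z' j))))
      = (\<Prod>j\<in>{0..K}. g j (z' j))" for z'
  proof (cases "\<exists>j\<in>{0..K}. z j = 0 \<and> z' j = 1")
    case True
    then have "\<exists>j\<in>{0..K}. g j (z' j) = 0"
      unfolding g_def by (metis (no_types))
    then have "(\<Prod>j\<in>{0..K}. g j (z' j)) = 0"
      by (intro prod_zero) auto
    with True show ?thesis
      by (simp only: if_True)
  next
    case False
    then have "g j (z' j) = p j ^ (z j * z' j) * (1 - p j) ^ (z j * (1 - z' j))"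
      if "j \<in> {0..K}" for j
      using that unfolding g_def by (metis (no_types))
    with False show ?thesis
      by (simp only: if_False cong: prod.cong)
  qed
  moreover have "real (z' i) * (\<Prod>j\<in>{0..K}. g j (z' j)) = (\<Prod>j\<in>{0..K}. g' j (z' j))" for z'
    using i by (simp add: g'_def prod.distrib)
  ultimately have "(\<Sum>z'\<in>Zset K. real (z' i) * (if \<exists>j\<in>{0..K}. z j = 0 \<and> z' j = 1 then 0
      else (\<Prod>j\<in>{0..K}. p j ^ (z j * z' j) * (1 - p j) ^ (z j * (1 - z' j)))))
      = (\<Sum>z'\<in>Pi\<^sub>E {0..K} (\<lambda>_. {0, 1}). \<Prod>j\<in>{0..K}. g' j (z' j))"
    by (simp add: Zset_def)
  also have "\<dots> = (\<Prod>j\<in>{0..K}. \<Sum>m\<in>{0, 1}. g' j m)"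
    by (rule prod_sum_PiE[symmetric]) auto
  also have "\<dots> = (\<Prod>j\<in>{0..K}. if j = i then real (z i) * p i else 1)"
    using z01 by (intro prod.cong) (force simp: g'_def g_def)+
  also have "\<dots> = real (z i) * p i"
    using i by simp
  finally show ?thesis .
qed

context
  fixes K :: nat and Q :: "'x::finite \<Rightarrow> 'a::finite \<Rightarrow> 'x pmf"
    and f :: "nat \<Rightarrow> nat \<Rightarrow> 'x \<Rightarrow> 'a \<Rightarrow> 'x \<Rightarrow> real" and t :: nat
  assumes f: "\<And>i x a x'. i \<le> K \<Longrightarrow> 0 \<le> f t i x a x' \<and> f t i x a x' \<le> 1"
begin

text \<open>The bounds on \<open>f\<close> make the mass function of \<open>Qbar\<close> the
  intended one. The kernel into epoch \<open>Suc t\<close> reads \<open>f\<close> at epoch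
  \<open>t\<close>.\<close>

lemma set_pmf_Qbar:
  assumes "y \<in> aug_states K"
  shows "set_pmf (Qbar K Q f (Suc t) y a) \<subseteq> aug_states K"
  using pmf_Qbar[of y K f "Suc t" Q a, OF assms] f by (auto simp: set_pmf_iff split: if_splits)

text \<open>The probability of the next state is pulled out so that the inner sum has the shape of
  \<open>Zset_sum_one\<close> and \<open>Zset_sum_coord\<close>.\<close>

lemma expectation_Qbar:
  assumes z: "z \<in> Zset K"
  shows "measure_pmf.expectation (Qbar K Q f (Suc t) (x, z) a) g
    = (\<Sum>x'\<in>UNIV. pmf (Q x a) x' * (\<Sum>z'\<in>Zset K. g (x', z') *
      (if \<exists>i\<in>{0..K}. z i = 0 \<and> z' i = 1 then 0
       else (\<Prod>i\<in>{0..K}. f t i x a x' ^ (z i * z' i) * (1 - f t i x a x') ^ (z i * (1 - z' i))))))"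
proof -
  have xz: "(x, z) \<in> aug_states K"
    using z by (simp add: aug_states_def)
  have pull: "(if c then 0 else p * q) * u = p * (u * (if c then 0 else q))" for c and p q u :: real
    by simp
  have "measure_pmf.expectation (Qbar K Q f (Suc t) (x, z) a) g
      = (\<Sum>y\<in>aug_states K. pmf (Qbar K Q f (Suc t) (x, z) a) y *\<^sub>R g y)"
    by (rule integral_measure_pmf)
      (use set_pmf_Qbar[OF xz] finite_Zset in \<open>auto simp: aug_states_def\<close>)
  also have "\<dots> = (\<Sum>y\<in>aug_states K. Qbar_mass K Q f (Suc t) (x, z) a y * g y)"
    using f by (intro sum.cong) (auto simp: pmf_Qbar[OF xz])
  also have "\<dots> = (\<Sum>x'\<in>UNIV. \<Sum>z'\<in>Zset K. Qbar_mass K Q f (Suc t) (x, z) a (x', z') * g (x', z'))"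
    by (simp add: aug_states_def sum.cartesian_product)
  also have "\<dots> = (\<Sum>x'\<in>UNIV. pmf (Q x a) x' * (\<Sum>z'\<in>Zset K. g (x', z') *
      (if \<exists>i\<in>{0..K}. z i = 0 \<and> z' i = 1 then 0
       else (\<Prod>i\<in>{0..K}. f t i x a x' ^ (z i * z' i) * (1 - f t i x a x') ^ (z i * (1 - z' i))))))"
    unfolding Qbar_mass_def prod.case sum_distrib_left
    by (intro sum.cong refl) (simp only: diff_Suc_1 pull)
  finally show ?thesis .
qed

lemma expectation_Qbar_state:
  fixes h :: "'x \<Rightarrow> real"
  assumes z: "z \<in> Zset K"
  shows "measure_pmf.expectation (Qbar K Q f (Suc t) (x, z) a) (\<lambda>y. h (fst y))
    = measure_pmf.expectation (Q x a) h"
proof -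
  have "measure_pmf.expectation (Qbar K Q f (Suc t) (x, z) a) (\<lambda>y. h (fst y))
    = (\<Sum>x'\<in>UNIV. pmf (Q x a) x' * h x')"
    unfolding expectation_Qbar[OF z] fst_conv sum_distrib_left[symmetric] Zset_sum_one[OF z]
    by simp
  also have "\<dots> = measure_pmf.expectation (Q x a) h"
    by (subst integral_measure_pmf[of UNIV]) auto
  finally show ?thesis .
qed

text \<open>The survival probability depends on the next state, hence stays inside the mean over
  \<open>Q\<close>. The test function \<open>h\<close> is carried along to allow iteration over
  epochs.\<close>

lemma expectation_Qbar_flag:
  assumes z: "z \<in> Zset K" and i: "i \<le> K"
  shows "measure_pmf.expectation (Qbar K Q f (Suc t) (x, z) a) (\<lambda>y. real (snd y i) * h (fst y))
    = real (z i) * measure_pmf.expectation (Q x a) (\<lambda>x'. f t i x a x' * h x')"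
proof -
  have "measure_pmf.expectation (Qbar K Q f (Suc t) (x, z) a) (\<lambda>y. real (snd y i) * h (fst y))
    = (\<Sum>x'\<in>UNIV. pmf (Q x a) x' * (h x' * (real (z i) * f t i x a x')))"
    unfolding expectation_Qbar[OF z] fst_conv snd_conv mult.commute[of _ "h _"] mult.assoc
      sum_distrib_left[symmetric] Zset_sum_coord[OF z i] ..
  also have "\<dots> = real (z i) * measure_pmf.expectation (Q x a) (\<lambda>x'. f t i x a x' * h x')"
    by (subst integral_measure_pmf[of UNIV]) (auto simp: sum_distrib_left mult_ac)
  finally show ?thesis .
qed

end

section \<open>Equality of the costs of a flag-blind policy and its image\<close>

context
  fixes T K :: nat and Q :: "'x::finite \<Rightarrow> 'a::finite \<Rightarrow> 'x pmf"
    and f :: "nat \<Rightarrow> nat \<Rightarrow> 'x \<Rightarrow> 'a \<Rightarrow> 'x \<Rightarrow> real" and s :: 'x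
    and \<eta> :: "nat \<Rightarrow> 'x \<times> (nat \<Rightarrow> nat) \<Rightarrow> 'a pmf"
  assumes f: "\<And>t i x a x'. t < T \<Longrightarrow> i \<le> K \<Longrightarrow> 0 \<le> f t i x a x' \<and> f t i x a x' \<le> 1"
    and \<eta>: "\<eta> \<in> Pi_bar T K"
begin

interpretation orig: finite_chain "\<lambda>_. Q" "Gamma_map T K \<eta>" s UNIV T
  by standard auto

interpretation aug: finite_chain "Qbar K Q f" \<eta> "(s, ones K)" "aug_states K" T
  using set_pmf_Qbar[of K f] f
  by unfold_locales (simp_all add: aug_states_def finite_Zset ones_in_Zset)

text \<open>This is where indifference to the flags enters; equality of all point masses gives
  equality of the distributions.\<close>

lemma policy_eq_Gamma_map: "t < T \<Longrightarrow> z \<in> Zset K \<Longrightarrow> \<eta> t (x, z) = Gamma_map T K \<eta> t x"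
  using \<eta> by (auto simp: Pi_bar_def Gamma_map_def intro: pmf_eqI)

lemma step_mean_state:
  assumes "n < T" "y \<in> aug_states K"
  shows "step_mean (Qbar K Q f) \<eta> n (\<lambda>_ _ y'. h (fst y')) y
    = step_mean (\<lambda>_. Q) (Gamma_map T K \<eta>) n (\<lambda>_ _. h) (fst y)"
  using assms f
  by (cases y) (auto simp: step_mean_def aug_states_def policy_eq_Gamma_map expectation_Qbar_state)

text \<open>The current flag is a constant factor given \<open>y\<close>; as the action law ignores
  flags, what remains is a function of the original state only.\<close>

lemma step_mean_flag:
  assumes "n < T" "y \<in> aug_states K" "i \<le> K"
  shows "step_mean (Qbar K Q f) \<eta> n (\<lambda>_ _ y'. real (snd y' i) * h (fst y')) y
    = real (snd y i) * step_mean (\<lambda>_. Q) (Gamma_map T K \<eta>) n (\<lambda>x a x'. f n i x a x' * h x') (fst y)"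
  using assms f
  by (cases y) (auto simp: step_mean_def aug_states_def policy_eq_Gamma_map expectation_Qbar_flag)

lemma mean_state_eq:
  "n \<le> T \<Longrightarrow> aug.mean n (\<lambda>(Y, A). h (fst (Y n))) = orig.mean n (\<lambda>(X, A). h (X n))"
\<comment> \<open>\<open>h\<close> is general because going back one epoch replaces it by its
  one-step mean.\<close>
proof (induction n arbitrary: h)
  case 0
  then show ?case by simp
next
  case (Suc n)
  then have n: "n < T" by simp
  have "aug.mean (Suc n) (\<lambda>(Y, A). h (fst (Y (Suc n))))
      = aug.mean n (\<lambda>(Y, A). step_mean (\<lambda>_. Q) (Gamma_map T K \<eta>) n (\<lambda>_ _. h) (fst (Y n)))"
    unfolding aug.mean_state_Suc[OF n, of "\<lambda>y. h (fst y)"]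
    by (rule aug.mean_cong) (use n step_mean_state in auto)
  also have "\<dots> = orig.mean (Suc n) (\<lambda>(X, A). h (X (Suc n)))"
    using Suc by (simp add: orig.mean_state_Suc)
  finally show ?case .
qed

lemma mean_flag_eq:
  assumes i: "i \<le> K"
  shows "n \<le> T \<Longrightarrow> aug.mean n (\<lambda>(Y, A). real (snd (Y n) i) * h (fst (Y n)))
    = orig.mean n (\<lambda>(X, A). (\<Prod>t<n. f t i (X t) (A t) (X (Suc t))) * h (X n))"
proof (induction n arbitrary: h)
  case 0
  \<comment> \<open>The chain starts with all flags 1, matching the empty product.\<close>
  then show ?case using i by (simp add: ones_def)
next
  case (Suc n)
  then have n: "n < T" by simp
  let ?h = "step_mean (\<lambda>_. Q) (Gamma_map T K \<eta>) n (\<lambda>x a x'. f n i x a x' * h x')"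
  have "aug.mean (Suc n) (\<lambda>(Y, A). real (snd (Y (Suc n)) i) * h (fst (Y (Suc n))))
      = aug.mean n (\<lambda>(Y, A). real (snd (Y n) i) * ?h (fst (Y n)))"
    \<comment> \<open>In the augmented chain the flag is part of the state, so the plain one-step
      rule applies; the factor \<open>f n i\<close> then appears inside \<open>?h\<close>.\<close>
    unfolding aug.mean_state_Suc[OF n, of "\<lambda>y. real (snd y i) * h (fst y)"]
    by (rule aug.mean_cong) (use n i step_mean_flag in auto)
  also have "\<dots> = orig.mean n (\<lambda>(X, A). (\<Prod>t<n. f t i (X t) (A t) (X (Suc t))) * ?h (X n))"
    using Suc.IH[of ?h] n by simp
  also have "\<dots> = orig.mean (Suc n)
      (\<lambda>(X, A). (\<Prod>t<Suc n. f t i (X t) (A t) (X (Suc t))) * h (X (Suc n)))"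
    by (rule orig.mean_multiplicative_Suc[OF n, of "\<lambda>t. f t i", symmetric])
  finally show ?case .
qed

text \<open>\<open>rbar\<close> already averages \<open>r\<close> over the next state; as an
  integrand it is constant in the next augmented state, so the kernel integrates out.\<close>

lemma step_mean_rbar:
  assumes "n < T" "y \<in> aug_states K"
  shows "step_mean (Qbar K Q f) \<eta> n (\<lambda>y a _. rbar Q r n i y a) y
    = step_mean (\<lambda>_. Q) (Gamma_map T K \<eta>) n (r n i) (fst y)"
proof -
  have "rbar Q r n i y a = measure_pmf.expectation (Q (fst y) a) (r n i (fst y) a)" for y :: "'x \<times> (nat \<Rightarrow> nat)" and a
    by (subst integral_measure_pmf[of UNIV]) (auto simp: rbar_def case_prod_unfold mult.commute)
  then show ?thesis
    using assms by (cases y) (auto simp: step_mean_def aug_states_def policy_eq_Gamma_map)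
qed

lemma v_cost_eq_w_cost:
  assumes i: "i \<le> K"
  shows "v_cost T K Q r f \<alpha> i \<eta> (s, ones K) = w_cost T Q r f \<alpha> i (Gamma_map T K \<eta>) s"
proof -
  have "aug.mean T (\<lambda>(Y, A). \<Sum>t<T. rbar Q r t i (Y t) (A t))
      = (\<Sum>t<T. aug.mean t (\<lambda>(Y, A). step_mean (Qbar K Q f) \<eta> t (\<lambda>y a _. rbar Q r t i y a) (Y t)))"
    using aug.mean_additive[of T "\<lambda>t y a _. rbar Q r t i y a"] by simp
  also have "\<dots> = (\<Sum>t<T. aug.mean t
      (\<lambda>(Y, A). step_mean (\<lambda>_. Q) (Gamma_map T K \<eta>) t (r t i) (fst (Y t))))"
    by (intro sum.cong refl aug.mean_cong) (auto simp: step_mean_rbar)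
  also have "\<dots> = orig.mean T (\<lambda>(X, A). \<Sum>t<T. r t i (X t) (A t) (X (Suc t)))"
    by (simp add: orig.mean_additive[of T "\<lambda>t. r t i"] mean_state_eq)
  finally have running: "aug.mean T (\<lambda>(Y, A). \<Sum>t<T. rbar Q r t i (Y t) (A t))
      = orig.mean T (\<lambda>(X, A). \<Sum>t<T. r t i (X t) (A t) (X (Suc t)))" .
  have terminal: "aug.mean T (\<lambda>(Y, A). rbar_terminal \<alpha> i (Y T))
      = orig.mean T (\<lambda>(X, A). \<alpha> i * (\<Prod>t<T. f t i (X t) (A t) (X (Suc t))))"
    \<comment> \<open>The constant test function \<open>\<alpha> i\<close> turns the flag identity
      into the terminal cost.\<close>
    using mean_flag_eq[OF i order_refl, of "\<lambda>_. \<alpha> i"]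
    by (simp add: rbar_terminal_def case_prod_unfold mult.commute)
  have "v_cost T K Q r f \<alpha> i \<eta> (s, ones K)
      = aug.mean T (\<lambda>(Y, A). \<Sum>t<T. rbar Q r t i (Y t) (A t))
        + aug.mean T (\<lambda>(Y, A). rbar_terminal \<alpha> i (Y T))"
    unfolding v_cost_def
    by (subst Bochner_Integration.integral_add[symmetric])
      (auto simp: case_prod_unfold intro!: aug.integrable_trajectory)
  also have "\<dots> = w_cost T Q r f \<alpha> i (Gamma_map T K \<eta>) s"
    unfolding w_cost_def running terminal
    by (subst Bochner_Integration.integral_add[symmetric])
      (auto simp: case_prod_unfold intro!: orig.integrable_trajectory)
  finally show ?thesis .
qed

end

section \<open>Transfer of the constrained problems along a cost-preserving surjection\<close>

lemma Gamma_map_image: "Gamma_map T K ` Pi_bar T K = MR_policies T (UNIV :: 'x set)"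
proof (intro equalityI subsetI)
  fix \<pi> :: "nat \<Rightarrow> 'x \<Rightarrow> 'a pmf"
  assume \<pi>: "\<pi> \<in> MR_policies T UNIV"
  \<comment> \<open>The preimage repeats \<open>\<pi>\<close> at every flag vector; restricting both
    arguments supplies the extensionality demanded by \<open>MR_policies\<close>.\<close>
  define \<eta> :: "nat \<Rightarrow> 'x \<times> (nat \<Rightarrow> nat) \<Rightarrow> 'a pmf"
    where "\<eta> = (\<lambda>t\<in>{..<T}. \<lambda>y\<in>aug_states K. \<pi> t (fst y))"
  have "\<eta> \<in> Pi_bar T K"
    using ones_in_Zset[of K] by (auto simp: \<eta>_def Pi_bar_def MR_policies_def aug_states_def)
  moreover have "Gamma_map T K \<eta> = \<pi>"
    using \<pi> ones_in_Zset[of K]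
    by (auto simp: \<eta>_def Gamma_map_def aug_states_def MR_policies_def fun_eq_iff
        PiE_def extensional_def)
  ultimately show "\<pi> \<in> Gamma_map T K ` Pi_bar T K"
    by blast
qed (auto simp: Gamma_map_def MR_policies_def)

text \<open>Preserved costs make feasibility of \<open>p\<close> and \<open>G p\<close> equivalent,
  and surjectivity provides a preimage for every feasible point of the target.\<close>

lemma feasible_set_image:
  assumes "G ` Pol = Pol'" "\<And>p i. p \<in> Pol \<Longrightarrow> i \<le> K \<Longrightarrow> c i p = c' i (G p)"
  shows "feasible_set Pol' c' K b = G ` feasible_set Pol c K b"
proof -
  have "p \<in> feasible_set Pol c K b \<longleftrightarrow> G p \<in> feasible_set Pol' c' K b" if "p \<in> Pol" for p
    using assms that by (auto simp: feasible_set_def)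
  moreover have "feasible_set Pol c K b \<subseteq> Pol" "feasible_set Pol' c' K b \<subseteq> G ` Pol"
    using assms(1) by (auto simp: feasible_set_def)
  ultimately show ?thesis
    by blast
qed

lemma optimal_value_image:
  assumes "G ` Pol = Pol'" "\<And>p i. p \<in> Pol \<Longrightarrow> i \<le> K \<Longrightarrow> c i p = c' i (G p)"
  shows "optimal_value Pol' c' K b = optimal_value Pol c K b"
proof -
  have "feasible_set Pol' c' K b = G ` feasible_set Pol c K b"
    by (rule feasible_set_image) (use assms in auto)
  then show ?thesis
    unfolding optimal_value_def image_image
    using assms(2) by (auto simp: feasible_set_def image_image intro!: INF_cong)
qed

text \<open>Feasibility, the objective (cost index 0) and the optimal value all agree at
  \<open>p\<close> and \<open>G p\<close>.\<close>

lemma is_optimizer_image: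
  assumes "G ` Pol = Pol'" "\<And>p i. p \<in> Pol \<Longrightarrow> i \<le> K \<Longrightarrow> c i p = c' i (G p)" "p \<in> Pol"
  shows "is_optimizer Pol c K b p \<longleftrightarrow> is_optimizer Pol' c' K b (G p)"
proof -
  have "p \<in> feasible_set Pol c K b \<longleftrightarrow> G p \<in> feasible_set Pol' c' K b"
    using assms by (auto simp: feasible_set_def)
  then show ?thesis
    using assms(2)[OF assms(3), of 0] optimal_value_image[of G Pol Pol' K c c' b] assms(1,2)
    by (simp add: is_optimizer_def)
qed

theorem theorem1:
  fixes T K :: nat
    and Q :: "'x::finite \<Rightarrow> 'a::finite \<Rightarrow> 'x pmf"
    and r f :: "nat \<Rightarrow> nat \<Rightarrow> 'x \<Rightarrow> 'a \<Rightarrow> 'x \<Rightarrow> real"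
    and \<alpha> b :: "nat \<Rightarrow> real"
    and s :: 'x
  assumes "T > 0"
    and "\<And>t i x a x'. t < T \<Longrightarrow> i \<le> K \<Longrightarrow> 0 \<le> f t i x a x' \<and> f t i x a x' \<le> 1"
    and "\<And>i. i \<le> K \<Longrightarrow> \<alpha> i \<noteq> 0"
  shows "optimal_value (MR_policies T UNIV) (\<lambda>i \<pi>. w_cost T Q r f \<alpha> i \<pi> s) K b
      = optimal_value (Pi_bar T K) (\<lambda>i \<eta>. v_cost T K Q r f \<alpha> i \<eta> (s, ones K)) K b
    \<and> (\<forall>\<eta>\<in>Pi_bar T K.
        is_optimizer (Pi_bar T K) (\<lambda>i \<eta>. v_cost T K Q r f \<alpha> i \<eta> (s, ones K)) K b \<eta>
        \<longleftrightarrow> is_optimizer (MR_policies T UNIV) (\<lambda>i \<pi>. w_cost T Q r f \<alpha> i \<pi> s) K b (Gamma_map T K \<eta>))"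
proof -
  have cost: "v_cost T K Q r f \<alpha> i \<eta> (s, ones K) = w_cost T Q r f \<alpha> i (Gamma_map T K \<eta>) s"
    if "\<eta> \<in> Pi_bar T K" "i \<le> K" for \<eta> i
    by (rule v_cost_eq_w_cost) (use assms that in auto)
  show ?thesis
    by (intro conjI ballI optimal_value_image[OF Gamma_map_image] is_optimizer_image[OF Gamma_map_image])
      (use cost in auto)
qed

end
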